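(* Let $L$ be a finite, dually slim, lower semimodular lattice. If $a_1,a_2\in L\setminus\{0,1\}$ and $\langle a_1,a_2\rangle\in \mathrm{ComplP}(L)\cap\mathrm{PseudCP}(L)$, then $a_1,a_2\in \mathrm{Mi}(L)$.
   Context: $0$ and $1$ denote the least and greatest elements of the finite lattice $L$. We write $x\prec y$ if $y$ covers $x$; $x\preceq y$ means $x\prec y$ or $x=y$. $L$ is lower semimodular if $a\prec b$ implies $a\wedge c\preceq b\wedge c$ for all $a,b,c\in L$. $\mathrm{Mi}(L)$ is the set of meet-irreducible elements of $L$, i.e. elements having exactly one (upper) cover. $L$ is dually slim if $\mathrm{Mi}(L)$ contains no three-element antichain. For $a,b\in L$, $\langle a,b\rangle$ is a complemented pair if $a\wedge b=0$ and $a\vee b=1$. The pseudocomplement of $a\in L$, if it exists, is the largest element $c\in L$ such that $a\wedge c=0$. The pair $\langle a,b\rangle$ is a pseudocomplemented pair if $b$ is the pseudocomplement of $a$ and $a$ is the pseudocomplement of $b$. $\mathrm{ComplP}(L)$ and $\mathrm{PseudCP}(L)$ denote the sets of all complemented pairs and of all pseudocomplemented pairs $\langle a,b\rangle\in L^2$, respectively. *)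

theory Defs
  imports Main
begin

text \<open>
  A finite lattice is a type of class \<open>finite\<close> and \<open>bounded_lattice\<close>, with meet \<^const>\<open>inf\<close>,
  join \<^const>\<open>sup\<close>, \<open>0 = bot\<close> and \<open>1 = top\<close>. Properties of the whole lattice are predicates
  on \<open>TYPE('a)\<close>.
\<close>

definition covered_by :: "'a::order \<Rightarrow> 'a \<Rightarrow> bool"  (infix \<open>\<prec>\<close> 50)
  where "x \<prec> y \<longleftrightarrow> x < y \<and> \<not> (\<exists>z. x < z \<and> z < y)"

definition covered_by_eq :: "'a::order \<Rightarrow> 'a \<Rightarrow> bool"  (infix \<open>\<preceq>\<close> 50)
  where "x \<preceq> y \<longleftrightarrow> x \<prec> y \<or> x = y"

definition lower_semimodular :: "'a::lattice itself \<Rightarrow> bool"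
  where "lower_semimodular T \<longleftrightarrow> (\<forall>a b c :: 'a. a \<prec> b \<longrightarrow> inf a c \<preceq> inf b c)"

definition Mi :: "'a::order set"
  where "Mi = {x. \<exists>!y. x \<prec> y}"

definition antichain :: "'a::order set \<Rightarrow> bool"
  where "antichain A \<longleftrightarrow> (\<forall>x\<in>A. \<forall>y\<in>A. x \<noteq> y \<longrightarrow> \<not> x \<le> y)"

definition dually_slim :: "'a::order itself \<Rightarrow> bool"
  where "dually_slim T \<longleftrightarrow> \<not> (\<exists>A :: 'a set. A \<subseteq> Mi \<and> card A = 3 \<and> antichain A)"

definition is_pseudocomplement :: "'a::bounded_lattice \<Rightarrow> 'a \<Rightarrow> bool"
  where "is_pseudocomplement a c \<longleftrightarrow> inf a c = bot \<and> (\<forall>x. inf a x = bot \<longrightarrow> x \<le> c)"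
  \<comment> \<open>\<open>c\<close> is the pseudocomplement of \<open>a\<close>; a relation, since it need not exist.\<close>

definition ComplP :: "('a::bounded_lattice \<times> 'a) set"
  where "ComplP = {(a, b). inf a b = bot \<and> sup a b = top}"

definition PseudCP :: "('a::bounded_lattice \<times> 'a) set"
  where "PseudCP = {(a, b). is_pseudocomplement a b \<and> is_pseudocomplement b a}"

end

theory Submission
  imports Defs
begin

text \<open>
  An element \<open>a \<noteq> 1\<close> that is not meet-irreducible has two distinct covers, and these are
  separated by two incomparable meet-irreducibles \<open>p\<close>, \<open>q\<close> above \<open>a\<close>
  (\<open>incomparable_Mi_above\<close>). If moreover \<open>b \<noteq> 1\<close> is a complement of \<open>a\<close>, then \<open>b\<close> lies below
  some meet-irreducible \<open>m\<close>, and \<open>m\<close> is incomparable to both \<open>p\<close> and \<open>q\<close>: the larger of two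
  comparable elements, one above \<open>a\<close> and one above \<open>b\<close>, is at least \<open>a \<squnion> b = 1\<close>, whereas \<open>1\<close> has
  no cover. So \<open>p\<close>, \<open>q\<close>, \<open>m\<close> form an antichain, contradicting dual slimness. As
  complementation is symmetric, this settles both components of the pair.
\<close>

lemma top_not_in_Mi: "(top :: 'a::bounded_lattice) \<notin> Mi"
  by (auto simp: Mi_def covered_by_def top.not_eq_extremum[symmetric])

text \<open>
  Among the elements above \<open>c\<close> but not above \<open>d\<close>, a maximal one \<open>p\<close> is meet-irreducible: everything
  strictly above \<open>p\<close> is also above \<open>d\<close>, so \<open>p \<squnion> d\<close> is its only cover.
\<close>

lemma Mi_separates:
  fixes c d :: "'a :: {finite, lattice}"
  assumes "\<not> d \<le> c"
  obtains p where "p \<in> Mi" "c \<le> p" "\<not> d \<le> p"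
proof -
  have "finite {x. c \<le> x \<and> \<not> d \<le> x}" "c \<in> {x. c \<le> x \<and> \<not> d \<le> x}"
    using assms by auto
  then obtain p where p: "c \<le> p" "\<not> d \<le> p"
    and max: "\<And>x. c \<le> x \<Longrightarrow> \<not> d \<le> x \<Longrightarrow> p \<le> x \<Longrightarrow> p = x"
    using finite_has_maximal2[of "{x. c \<le> x \<and> \<not> d \<le> x}" c] by auto
  have above: "sup p d \<le> x" if "p < x" for x
    using that p(1) max[of x] by (metis le_supI less_le order_trans)
  have less: "p < sup p d"
    using p(2) by (metis less_le sup_ge1 sup_ge2)
  have "p \<prec> sup p d"
    unfolding covered_by_def using less above by (metis leD)
  moreover have "y = sup p d" if "p \<prec> y" for y
    using that above[of y] less unfolding covered_by_def by (metis le_less)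
  ultimately have "p \<in> Mi"
    unfolding Mi_def by blast
  with p that show thesis by blast
qed

lemma exists_cover:
  fixes a b :: "'a :: {finite, order}"
  assumes "a < b"
  obtains c where "a \<prec> c"
proof -
  obtain c where "a < c" "\<And>x. a < x \<Longrightarrow> x \<le> c \<Longrightarrow> c = x"
    using finite_has_minimal2[of "{x. a < x}" b] assms by auto
  then have "a \<prec> c"
    unfolding covered_by_def by (metis less_le)
  with that show thesis .
qed

lemma incomparable_Mi_above:
  fixes a :: "'a :: {finite, bounded_lattice}"
  assumes "a \<noteq> top" "a \<notin> Mi"
  obtains p q where "p \<in> Mi" "q \<in> Mi" "a \<le> p" "a \<le> q" "\<not> p \<le> q" "\<not> q \<le> p"
proof -
  obtain c where c: "a \<prec> c"
    using exists_cover[of a top] assms(1) by (auto simp: top.not_eq_extremum)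
  then obtain d where d: "a \<prec> d" "d \<noteq> c"
    using assms(2) unfolding Mi_def by blast
  have "\<not> d \<le> c" "\<not> c \<le> d"
    using c d unfolding covered_by_def by (metis less_le)+
  obtain p where p: "p \<in> Mi" "c \<le> p" "\<not> d \<le> p"
    using Mi_separates[OF \<open>\<not> d \<le> c\<close>] .
  obtain q where q: "q \<in> Mi" "d \<le> q" "\<not> c \<le> q"
    using Mi_separates[OF \<open>\<not> c \<le> d\<close>] .
  have "a \<le> p" "a \<le> q"
    using c d p q unfolding covered_by_def by (metis less_imp_le order_trans)+
  moreover have "\<not> p \<le> q" "\<not> q \<le> p"
    using p q by (metis order_trans)+
  ultimately show thesis
    using that p(1) q(1) by blast
qed

text \<open>
  A meet-irreducible above \<open>b\<close> would be a third member of an antichain formed with two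
  incomparable meet-irreducibles above \<open>a\<close>.
\<close>

lemma Mi_if_sup_eq_top:
  fixes a b :: "'a :: {finite, bounded_lattice}"
  assumes slim: "dually_slim TYPE('a)"
    and "sup a b = top" "a \<noteq> top" "b \<noteq> top"
  shows "a \<in> Mi"
proof (rule ccontr)
  assume "a \<notin> Mi"
  then obtain p q where pq: "p \<in> Mi" "q \<in> Mi" "a \<le> p" "a \<le> q" "\<not> p \<le> q" "\<not> q \<le> p"
    using incomparable_Mi_above assms(3) by blast
  obtain m where m: "m \<in> Mi" "b \<le> m"
    using Mi_separates[of top b] assms(4) by (auto simp: top_unique)
  have no_common_bound: False if "x \<in> Mi" "a \<le> x" "b \<le> x" for x
    using that assms(2) top_not_in_Mi by (metis sup_least top_unique)
  have incomparable: "\<not> x \<le> m \<and> \<not> m \<le> x" if "x \<in> Mi" "a \<le> x" for x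
    using that m no_common_bound by (meson order_trans)
  have "antichain {p, q, m}"
    using pq incomparable unfolding antichain_def by auto
  moreover have "card {p, q, m} = 3"
    using pq incomparable[of p] incomparable[of q] by (auto simp: card_insert_if)
  ultimately show False
    using slim pq(1,2) m(1) unfolding dually_slim_def
    by (metis empty_subsetI insert_subset)
qed

theorem corollary1p6:
  fixes a1 a2 :: "'a :: {finite, bounded_lattice}"
  assumes "dually_slim TYPE('a)"
    and "lower_semimodular TYPE('a)"
    and "a1 \<in> UNIV - {bot, top}" and "a2 \<in> UNIV - {bot, top}"
    and "(a1, a2) \<in> ComplP \<inter> PseudCP"
  shows "a1 \<in> Mi \<and> a2 \<in> Mi"
proof -
  have "sup a1 a2 = top"
    using assms(5) by (simp add: ComplP_def)
  then show ?thesis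
    using assms Mi_if_sup_eq_top[of a1 a2] Mi_if_sup_eq_top[of a2 a1]
    by (simp add: sup_commute)
qed

end
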